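(* Let $\mathcal{Z}\subseteq\mathbb{R}^n$ be a closed convex set and $F:\mathcal{Z}\to\mathbb{R}^n$ be a monotone and $L$-Lipschitz operator. Then for any $z_k,w_k\in\mathcal{Z}$, the optimistic gradient descent-ascent (OGDA) algorithm with any step size $\eta\in(0,\frac{1}{2L})$ produces $w_{k+1}=\Pi_{\mathcal{Z}}[z_k-\eta F(w_k)]$ and $z_{k+1}=\Pi_{\mathcal{Z}}[z_k-\eta F(w_{k+1})]$ in $\mathcal{Z}$ that satisfy $$\|F(z_k)-F(w_k)\|^2+r^{tan}_{(F,\mathcal{Z})}(z_k)^2\ \ge\ \|F(z_{k+1})-F(w_{k+1})\|^2+r^{tan}_{(F,\mathcal{Z})}(z_{k+1})^2.$$
   Context: $\|\cdot\|$ is the Euclidean norm and $\langle\cdot,\cdot\rangle$ the Euclidean inner product; $\Pi_C$ denotes Euclidean projection onto a closed convex set $C$. $F$ is monotone if $\langle F(z)-F(z'),z-z'\rangle\ge0$ for all $z,z'\in\mathcal{Z}$, and $L$-Lipschitz if $\|F(z)-F(z')\|\le L\|z-z'\|$ for all $z,z'\in\mathcal{Z}$ ($L>0$). Tangent residual: let $N_{\mathcal{Z}}(z)=\{v\in\mathbb{R}^n:\langle v,z'-z\rangle\le0\ \forall z'\in\mathcal{Z}\}$ be the normal cone, $T_{\mathcal{Z}}(z)=\{z'\in\mathbb{R}^n:\langle z',a\rangle\le0\ \forall a\in N_{\mathcal{Z}}(z)\}$ the tangent cone, and $J_{\mathcal{Z}}(z)=\{z\}+T_{\mathcal{Z}}(z)$.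 Then $r^{tan}_{(F,\mathcal{Z})}(z)=\|\Pi_{J_{\mathcal{Z}}(z)}[z-F(z)]-z\|$. *)

theory Defs
  imports "HOL-Analysis.Analysis"
begin

text \<open>
  An operator on \<open>Z \<subseteq> \<real>\<^sup>n\<close> is a total function of which only the values on \<open>Z\<close> matter.
  Euclidean projection onto a nonempty closed convex set is the library's \<^const>\<open>closest_point\<close>.
\<close>

definition monotone_operator_on :: "(real ^ 'n) set \<Rightarrow> (real ^ 'n \<Rightarrow> real ^ 'n) \<Rightarrow> bool" where
  "monotone_operator_on Z F \<longleftrightarrow> (\<forall>z\<in>Z. \<forall>z'\<in>Z. (F z - F z') \<bullet> (z - z') \<ge> 0)"

definition normal_cone :: "(real ^ 'n) set \<Rightarrow> real ^ 'n \<Rightarrow> (real ^ 'n) set" where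
  "normal_cone Z z = {v. \<forall>z'\<in>Z. v \<bullet> (z' - z) \<le> 0}"

definition tangent_cone :: "(real ^ 'n) set \<Rightarrow> real ^ 'n \<Rightarrow> (real ^ 'n) set" where
  "tangent_cone Z z = {z'. \<forall>a\<in>normal_cone Z z. z' \<bullet> a \<le> 0}"

definition shifted_tangent_cone :: "(real ^ 'n) set \<Rightarrow> real ^ 'n \<Rightarrow> (real ^ 'n) set" where
  "shifted_tangent_cone Z z = (\<lambda>v. z + v) ` tangent_cone Z z"

definition tangent_residual ::
    "(real ^ 'n \<Rightarrow> real ^ 'n) \<Rightarrow> (real ^ 'n) set \<Rightarrow> real ^ 'n \<Rightarrow> real" where
  "tangent_residual F Z z = norm (closest_point (shifted_tangent_cone Z z) (z - F z) - z)"

end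

theory Submission
  imports Defs
begin

text \<open>
  By Moreau's decomposition the tangent residual at \<open>z\<close> is the least value of \<open>\<parallel>F z + a\<parallel>\<close> over
  normal vectors \<open>a\<close> at \<open>z\<close>. So let \<open>a\<close> attain the residual at \<open>z\<close>, and bound the residual at \<open>z'\<close>
  by the normal vector \<open>c\<close> that the projection step produces. Rescale so that \<open>\<eta> = 1\<close>, and let
  \<open>A, B, C, D\<close> be the values of \<open>F\<close> at \<open>z, w, w', z'\<close>. Then \<open>w' = z - B - b\<close> and
  \<open>z' = z - C - c\<close> with \<open>b\<close> and \<open>c\<close> normal at \<open>w'\<close> and \<open>z'\<close>, and \<open>p = w' - z' = C + c - B - b\<close>.

  Subtracting twice \<open>(A + a - D - c) \<bullet> (z - z')\<close> from \<open>\<parallel>A + a\<parallel>\<^sup>2 - \<parallel>D + c\<parallel>\<^sup>2\<close> leaves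
  \<open>\<parallel>A + a - C - c\<parallel>\<^sup>2 - \<parallel>D - C\<parallel>\<^sup>2\<close>. By the parallelogram inequality,
  \<open>\<parallel>A - B\<parallel>\<^sup>2 + \<parallel>A + a - C - c\<parallel>\<^sup>2 \<ge> \<parallel>p + b - a\<parallel>\<^sup>2 / 2 \<ge> \<parallel>p\<parallel>\<^sup>2 / 2 + p \<bullet> (b - a)\<close>, and the Lipschitz
  bound with step size below \<open>1 / (2L)\<close> gives \<open>\<parallel>p\<parallel>\<^sup>2 / 2 \<ge> 2 \<parallel>D - C\<parallel>\<^sup>2\<close>. The one term of unclear
  sign, \<open>- p \<bullet> a\<close>, equals \<open>a \<bullet> (z - w') - a \<bullet> (z - z')\<close>; it is absorbed by the summand
  \<open>2 a \<bullet> (z - z')\<close> of the inner product subtracted first. What remains is nonnegative by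
  monotonicity and the definition of the normal vectors \<open>a, b, c\<close>.
\<close>

lemma normal_cone_scaleR:
  assumes "v \<in> normal_cone Z z" and "0 \<le> t"
  shows "t *\<^sub>R v \<in> normal_cone Z z"
  using assms by (auto simp: normal_cone_def mult_nonneg_nonpos)

lemma normal_coneD:
  assumes "v \<in> normal_cone Z z" and "x \<in> Z"
  shows "v \<bullet> (z - x) \<ge> 0"
  using assms by (auto simp: normal_cone_def inner_diff_right)

lemma closest_point_in_normal_cone:
  assumes "closed Z" and "convex Z"
  shows "x - closest_point Z x \<in> normal_cone Z (closest_point Z x)"
  using closest_point_dot[OF assms(2,1)] by (auto simp: normal_cone_def)

lemma diff_in_tangent_cone:
  assumes "x \<in> Z"
  shows "x - z \<in> tangent_cone Z z"
  using assms by (auto simp: tangent_cone_def normal_cone_def inner_commute)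

lemma tangent_cone_add:
  assumes "u \<in> tangent_cone Z z" and "v \<in> tangent_cone Z z"
  shows "u + v \<in> tangent_cone Z z"
  using assms by (fastforce simp: tangent_cone_def inner_add_left)

lemma closed_tangent_cone: "closed (tangent_cone Z z)"
proof -
  have "tangent_cone Z z = (\<Inter>a\<in>normal_cone Z z. {v. a \<bullet> v \<le> 0})"
    by (auto simp: tangent_cone_def inner_commute)
  then show ?thesis
    by (auto intro: closed_halfspace_le)
qed

lemma convex_tangent_cone: "convex (tangent_cone Z z)"
proof -
  have "tangent_cone Z z = (\<Inter>a\<in>normal_cone Z z. {v. a \<bullet> v \<le> 0})"
    by (auto simp: tangent_cone_def inner_commute)
  then show ?thesis
    by (auto intro: convex_INT convex_halfspace_le)
qed

text \<open>
  The variational characterisation of the projection, translated from the shifted cone to the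
  tangent cone itself; both bounds on the residual follow from it by choosing \<open>t\<close>.
\<close>

lemma tangent_residual_projection:
  obtains q where "q \<in> tangent_cone Z z" and "tangent_residual F Z z = norm q"
    and "\<And>t. t \<in> tangent_cone Z z \<Longrightarrow> (- F z - q) \<bullet> (t - q) \<le> 0"
proof -
  let ?J = "shifted_tangent_cone Z z"
  define q where "q = closest_point ?J (z - F z) - z"
  have "0 \<in> tangent_cone Z z"
    by (simp add: tangent_cone_def)
  then have ne: "?J \<noteq> {}"
    by (auto simp: shifted_tangent_cone_def)
  have J: "closed ?J" "convex ?J"
    by (simp_all add: shifted_tangent_cone_def closed_translation closed_tangent_cone
        convex_translation convex_tangent_cone)
  have "closest_point ?J (z - F z) \<in> ?J"
    using closest_point_in_set[OF J(1) ne] .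
  then have "q \<in> tangent_cone Z z"
    by (auto simp: q_def shifted_tangent_cone_def)
  moreover have "tangent_residual F Z z = norm q"
    by (simp add: tangent_residual_def q_def)
  moreover have "(- F z - q) \<bullet> (t - q) \<le> 0" if "t \<in> tangent_cone Z z" for t
  proof -
    have "z + t \<in> ?J"
      using that by (simp add: shifted_tangent_cone_def)
    from closest_point_dot[OF J(2,1) this, of "z - F z"] show ?thesis
      by (simp add: q_def algebra_simps)
  qed
  ultimately show thesis
    by (rule that)
qed

lemma tangent_residual_attained:
  obtains a where "a \<in> normal_cone Z z" and "norm (F z + a) = tangent_residual F Z z"
proof -
  obtain q where q: "q \<in> tangent_cone Z z" and r: "tangent_residual F Z z = norm q"
    and var: "\<And>t. t \<in> tangent_cone Z z \<Longrightarrow> (- F z - q) \<bullet> (t - q) \<le> 0"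
    using tangent_residual_projection[of Z z F] by blast
  have "(- F z - q) \<bullet> (x - z) \<le> 0" if "x \<in> Z" for x
    using var[OF tangent_cone_add[OF q diff_in_tangent_cone[OF that]]] by simp
  then have "- F z - q \<in> normal_cone Z z"
    by (simp add: normal_cone_def)
  then show thesis
    by (rule that) (simp add: r)
qed

lemma tangent_residual_le:
  assumes "c \<in> normal_cone Z z"
  shows "tangent_residual F Z z \<le> norm (F z + c)"
proof -
  obtain q where q: "q \<in> tangent_cone Z z" and r: "tangent_residual F Z z = norm q"
    and var: "\<And>t. t \<in> tangent_cone Z z \<Longrightarrow> (- F z - q) \<bullet> (t - q) \<le> 0"
    using tangent_residual_projection[of Z z F] by blast
  have "0 \<in> tangent_cone Z z"
    by (simp add: tangent_cone_def)
  from var[OF this] have "q \<bullet> q \<le> - (F z \<bullet> q)"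
    by (simp add: inner_diff_left)
  moreover have "c \<bullet> q \<le> 0"
    using q assms by (auto simp: tangent_cone_def inner_commute)
  ultimately have "norm q * norm q \<le> - (F z + c) \<bullet> q"
    by (simp add: inner_add_left inner_diff_left flip: power2_norm_eq_inner power2_eq_square)
  also have "\<dots> \<le> norm (F z + c) * norm q"
    using norm_cauchy_schwarz[of "- (F z + c)" q] by (metis norm_minus_cancel)
  finally show ?thesis
    using r by (cases "q = 0") auto
qed

text \<open>
  The inequality for unit step size, as a statement about vectors only: \<open>C + c\<close> stands for
  \<open>z - z'\<close>, \<open>B + b\<close> for \<open>z - w'\<close>, and \<open>(C + c) - (B + b)\<close> for \<open>w' - z'\<close>.
\<close>

lemma optimistic_step_descent:
  fixes A B C D a b c :: "'a::real_inner"
  assumes mono: "(A - D) \<bullet> (C + c) \<ge> 0"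
    and lip: "2 * norm (D - C) \<le> norm ((C + c) - (B + b))"
    and a1: "a \<bullet> (C + c) \<ge> 0" and a2: "a \<bullet> (B + b) \<ge> 0"
    and b: "b \<bullet> ((C + c) - (B + b)) \<ge> 0"
    and c: "c \<bullet> (C + c) \<le> 0"
  shows "(norm (D - C))\<^sup>2 + (norm (D + c))\<^sup>2 \<le> (norm (A - B))\<^sup>2 + (norm (A + a))\<^sup>2"
proof -
  let ?p = "(C + c) - (B + b)"
  \<comment> \<open>The right-hand side of this identity is a sum of terms that the assumptions make nonnegative.\<close>
  have "(norm (A - B))\<^sup>2 + (norm (A + a))\<^sup>2 - (norm (D - C))\<^sup>2 - (norm (D + c))\<^sup>2
    = 2 * ((A - D) \<bullet> (C + c)) + a \<bullet> (C + c) + a \<bullet> (B + b) + b \<bullet> ?p + 2 * - (c \<bullet> (C + c))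
      + ((norm ?p)\<^sup>2 - (2 * norm (D - C))\<^sup>2) / 2
      + (norm (b - a))\<^sup>2 / 2 + (norm ((A - B) + (A + a - (C + c))))\<^sup>2 / 2"
    by (simp add: power_mult_distrib power2_norm_eq_inner inner_simps inner_commute field_simps)
  also have "\<dots> \<ge> 0"
    using mono a1 a2 b c power_mono[OF lip, of 2]
    by (intro add_nonneg_nonneg) auto
  finally show ?thesis
    by simp
qed

theorem theorem7:
  fixes Z :: "(real ^ 'n) set"
    and F :: "real ^ 'n \<Rightarrow> real ^ 'n"
    and L \<eta> :: real
    and z w z' w' :: "real ^ 'n"
  assumes "closed Z" and "convex Z"
    and "monotone_operator_on Z F"
    and "L > 0" and "L-lipschitz_on Z F"
    and "0 < \<eta>" and "\<eta> < 1 / (2 * L)"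
    and "z \<in> Z" and "w \<in> Z"
    and "w' = closest_point Z (z - \<eta> *\<^sub>R F w)"
    and "z' = closest_point Z (z - \<eta> *\<^sub>R F w')"
  shows "w' \<in> Z \<and> z' \<in> Z \<and>
    (norm (F z - F w))\<^sup>2 + (tangent_residual F Z z)\<^sup>2
      \<ge> (norm (F z' - F w'))\<^sup>2 + (tangent_residual F Z z')\<^sup>2"
proof -
  have "Z \<noteq> {}"
    using \<open>z \<in> Z\<close> by auto
  then have w': "w' \<in> Z" and z': "z' \<in> Z"
    using closest_point_in_set[OF \<open>closed Z\<close>] assms(10,11) by auto
  define b where "b = z - \<eta> *\<^sub>R F w - w'"
  define c where "c = z - \<eta> *\<^sub>R F w' - z'"
  have bN: "b \<in> normal_cone Z w'" and cN: "c \<in> normal_cone Z z'"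
    using closest_point_in_normal_cone[OF assms(1,2)] assms(10,11)
    by (auto simp: b_def c_def)
  have zw: "\<eta> *\<^sub>R F w + b = z - w'" and zz: "\<eta> *\<^sub>R F w' + c = z - z'"
    by (simp_all add: b_def c_def)
  obtain a where aN: "a \<in> normal_cone Z z" and ar: "norm (F z + a) = tangent_residual F Z z"
    by (rule tangent_residual_attained[of Z z F])
  have eaN: "\<eta> *\<^sub>R a \<in> normal_cone Z z"
    using normal_cone_scaleR[OF aN] \<open>0 < \<eta>\<close> by simp
  have dN: "c /\<^sub>R \<eta> \<in> normal_cone Z z'"
    using normal_cone_scaleR[OF cN] \<open>0 < \<eta>\<close> by simp
  \<comment> \<open>The unit-step inequality for \<open>\<eta> F\<close>; the normal vector \<open>c\<close> belongs to \<open>\<eta> F\<close>, so \<open>c / \<eta>\<close> belongs to \<open>F\<close>.\<close>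
  have "(norm (\<eta> *\<^sub>R F z' - \<eta> *\<^sub>R F w'))\<^sup>2 + (norm (\<eta> *\<^sub>R F z' + c))\<^sup>2
      \<le> (norm (\<eta> *\<^sub>R F z - \<eta> *\<^sub>R F w))\<^sup>2 + (norm (\<eta> *\<^sub>R F z + \<eta> *\<^sub>R a))\<^sup>2"
  proof (rule optimistic_step_descent[where b = b], unfold zw zz)
    have "(F z - F z') \<bullet> (z - z') \<ge> 0"
      using assms(3) \<open>z \<in> Z\<close> z' by (simp add: monotone_operator_on_def)
    then show "(\<eta> *\<^sub>R F z - \<eta> *\<^sub>R F z') \<bullet> (z - z') \<ge> 0"
      using \<open>0 < \<eta>\<close> by (simp flip: scaleR_diff_right)
    have "norm (F z' - F w') \<le> L * norm (z' - w')"
      using lipschitz_onD[OF assms(5) z' w'] by (simp add: dist_norm)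
    then have "2 * \<eta> * norm (F z' - F w') \<le> (2 * \<eta> * L) * norm (z' - w')"
      using \<open>0 < \<eta>\<close> by simp
    also have "\<dots> \<le> 1 * norm (z' - w')"
      using assms(4,7) by (intro mult_right_mono) (auto simp: field_simps)
    finally show "2 * norm (\<eta> *\<^sub>R F z' - \<eta> *\<^sub>R F w') \<le> norm (z - z' - (z - w'))"
      using \<open>0 < \<eta>\<close> by (simp add: norm_minus_commute flip: scaleR_diff_right)
    show "\<eta> *\<^sub>R a \<bullet> (z - z') \<ge> 0" "\<eta> *\<^sub>R a \<bullet> (z - w') \<ge> 0"
      using normal_coneD[OF eaN] z' w' by blast+
    show "b \<bullet> (z - z' - (z - w')) \<ge> 0"
      using normal_coneD[OF bN z'] by simp
    show "c \<bullet> (z - z') \<le> 0"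
      using normal_coneD[OF cN \<open>z \<in> Z\<close>] by (simp add: inner_diff_right)
  qed
  moreover have "\<eta> *\<^sub>R F z' + c = \<eta> *\<^sub>R (F z' + c /\<^sub>R \<eta>)"
    using \<open>0 < \<eta>\<close> by (simp add: scaleR_add_right)
  ultimately have "\<eta>\<^sup>2 * ((norm (F z' - F w'))\<^sup>2 + (norm (F z' + c /\<^sub>R \<eta>))\<^sup>2)
      \<le> \<eta>\<^sup>2 * ((norm (F z - F w))\<^sup>2 + (norm (F z + a))\<^sup>2)"
    by (simp add: power_mult_distrib distrib_left
        flip: scaleR_diff_right scaleR_add_right)
  then have "(norm (F z' - F w'))\<^sup>2 + (norm (F z' + c /\<^sub>R \<eta>))\<^sup>2
      \<le> (norm (F z - F w))\<^sup>2 + (tangent_residual F Z z)\<^sup>2"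
    using \<open>0 < \<eta>\<close> ar by simp
  moreover have "(tangent_residual F Z z')\<^sup>2 \<le> (norm (F z' + c /\<^sub>R \<eta>))\<^sup>2"
    using tangent_residual_le[OF dN, of F]
    by (rule power_mono) (simp add: tangent_residual_def)
  ultimately show ?thesis
    using w' z' by linarith
qed

end
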